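(* Let $G$ be a connected $k$-regular graph and let $\lambda_2(G)$ be the second largest eigenvalue of its adjacency matrix. If $$\lambda_2(G)<\begin{cases}\frac{k-2+\sqrt{k^2+8}}{2} & \text{when } k \text{ is odd},\\ \frac{k-2+\sqrt{k^2+12}}{2} & \text{when } k \text{ is even},\end{cases}$$ then $t(G)\geq 1$.
   Context: All graphs are finite, simple and undirected. Adjacency eigenvalues of a graph on $n\ge 2$ vertices are listed with multiplicity as $\lambda_1\ge\lambda_2\ge\dots\ge\lambda_n$. For a connected graph $G$ and a vertex subset $S$, $c(G\setminus S)$ denotes the number of connected components of the graph obtained from $G$ by removing the vertices of $S$. The toughness of $G$ is $t(G)=\min_S \frac{|S|}{c(G\setminus S)}$, the minimum being over all vertex subsets $S$ whose removal disconnects $G$ (i.e. $c(G\setminus S)\ge 2$). If $G$ is complete (no such $S$ exists), then $t(G)=+\infty$ by convention. *)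

theory Defs
  imports
    "Graph_Theory.Graph_Theory"
    "Jordan_Normal_Form.Char_Poly"
    "HOL-Library.Extended_Real"
begin

text \<open>
  A finite simple undirected graph is an instance of the locale \<open>Digraph.graph\<close>: a finite
  symmetric digraph without loops and without multiple arcs, every edge being represented by a pair
  of opposite arcs. The qualified name distinguishes it from \<open>Map.graph\<close>; similarly
  \<open>Digraph_Component.connected\<close> is the graph-theoretic notion, not the topological one.
\<close>

text \<open>Each edge at \<open>v\<close> contributes exactly one arc leaving \<open>v\<close>, so \<open>out_degree\<close> is the degree.\<close>

definition regular :: "('a, 'b) pre_digraph \<Rightarrow> nat \<Rightarrow> bool" where
  "regular G k \<longleftrightarrow> (\<forall>v \<in> verts G. out_degree G v = k)"

definition adjacency_matrix_wrt :: "('a, 'b) pre_digraph \<Rightarrow> 'a list \<Rightarrow> real mat" where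
  "adjacency_matrix_wrt G vs =
     mat (length vs) (length vs) (\<lambda>(i, j). if vs ! i \<rightarrow>\<^bsub>G\<^esub> vs ! j then 1 else 0)"

text \<open>
  The matrix is indexed by natural numbers, so the vertices have to be enumerated. Which enumeration
  is chosen is irrelevant for the characteristic polynomial; see \<open>char_poly_adjacency_matrix\<close> below.
\<close>

definition vertex_enum :: "('a, 'b) pre_digraph \<Rightarrow> 'a list" where
  "vertex_enum G = (SOME vs. distinct vs \<and> set vs = verts G)"

definition adjacency_matrix :: "('a, 'b) pre_digraph \<Rightarrow> real mat" where
  "adjacency_matrix G = adjacency_matrix_wrt G (vertex_enum G)"

text \<open>
  The adjacency eigenvalues in non-increasing order, repeated according to multiplicity. For a graph
  the matrix is real symmetric, so its characteristic polynomial splits over the reals and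
  \<open>proots\<close> misses none of its roots. The list is indexed from 0, hence \<open>\<lambda>\<^sub>2\<close> is the entry at 1; it
  is meaningful only if there are at least two vertices.
\<close>

definition adjacency_eigenvalues :: "('a, 'b) pre_digraph \<Rightarrow> real list" where
  "adjacency_eigenvalues G =
     rev (sorted_list_of_multiset (proots (char_poly (adjacency_matrix G))))"

definition lambda2 :: "('a, 'b) pre_digraph \<Rightarrow> real" where
  "lambda2 G = adjacency_eigenvalues G ! 1"

text \<open>The strongly connected components of a symmetric digraph are its connected components.\<close>

definition num_components :: "('a, 'b) pre_digraph \<Rightarrow> nat" where
  "num_components G = card (pre_digraph.sccs G)"

definition disconnecting_sets :: "('a, 'b) pre_digraph \<Rightarrow> 'a set set" where
  "disconnecting_sets G = {S. S \<subseteq> verts G \<and> num_components (G \<restriction> (verts G - S)) \<ge> 2}"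

definition toughness :: "('a, 'b) pre_digraph \<Rightarrow> ereal" where
  "toughness G =
     (if disconnecting_sets G = {} then \<infinity>
      else ereal (Min ((\<lambda>S. real (card S) / real (num_components (G \<restriction> (verts G - S))))
                        ` disconnecting_sets G)))"

lemma vertex_enum:
  assumes "finite (verts G)"
  shows "distinct (vertex_enum G)" "set (vertex_enum G) = verts G"
proof -
  have "\<exists>vs. distinct vs \<and> set vs = verts G"
    using finite_distinct_list[OF assms] by blast
  then have "distinct (vertex_enum G) \<and> set (vertex_enum G) = verts G"
    unfolding vertex_enum_def by (rule someI_ex)
  then show "distinct (vertex_enum G)" "set (vertex_enum G) = verts G" by auto
qed

lemma char_poly_adjacency_matrix_wrt:
  assumes vs: "distinct vs" and ws: "distinct ws" and eq: "set vs = set ws"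
  shows "char_poly (adjacency_matrix_wrt G vs) = char_poly (adjacency_matrix_wrt G ws)"
proof -
  let ?n = "length vs"
  have len: "length ws = ?n"
    using vs ws eq by (metis distinct_card)
  define P :: "'a list \<Rightarrow> 'a list \<Rightarrow> real mat"
    where "P = (\<lambda>xs ys. mat ?n ?n (\<lambda>(i, j). if xs ! i = ys ! j then 1 else 0))"
  have pick: "(\<Sum>j = 0..<?n. (if x = ys ! j then 1 else 0) * f (ys ! j)) = (f x :: real)"
    if ys: "distinct ys" "length ys = ?n" "x \<in> set ys" for ys :: "'a list" and x f
  proof -
    have "(\<Sum>j = 0..<?n. (if x = ys ! j then 1 else 0) * f (ys ! j))
        = sum_list (map (\<lambda>y. (if x = y then 1 else 0) * f y) ys)"
      using ys(2) by (simp add: sum_list_sum_nth)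
    also have "\<dots> = (\<Sum>y \<in> set ys. (if x = y then 1 else 0) * f y)"
      using ys(1) by (rule sum_list_distinct_conv_sum_set)
    also have "\<dots> = (\<Sum>y \<in> set ys. if x = y then f y else 0)"
      by (rule sum.cong) auto
    also have "\<dots> = f x"
      using ys(3) by simp
    finally show ?thesis .
  qed
  have inv: "P xs ys * P ys xs = 1\<^sub>m ?n"
    if "distinct xs" "distinct ys" "length xs = ?n" "length ys = ?n" "set xs = set ys"
    for xs ys
  proof (rule eq_matI)
    fix i j assume "i < dim_row (1\<^sub>m ?n :: real mat)" "j < dim_col (1\<^sub>m ?n :: real mat)"
    then have ij: "i < ?n" "j < ?n" by auto
    have mem: "xs ! i \<in> set ys"
      using nth_mem[of i xs] ij that by simp
    have "(P xs ys * P ys xs) $$ (i, j)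
        = (\<Sum>l = 0..<?n. (if xs ! i = ys ! l then 1 else 0) * (if ys ! l = xs ! j then 1 else 0))"
      using ij by (simp add: P_def scalar_prod_def)
    also have "\<dots> = (if xs ! i = xs ! j then 1 else 0)"
      by (rule pick[OF that(2) that(4) mem, where f = "\<lambda>y. if y = xs ! j then 1 else 0"])
    finally show "(P xs ys * P ys xs) $$ (i, j) = 1\<^sub>m ?n $$ (i, j)"
      using ij that by (simp add: nth_eq_iff_index_eq)
  qed (auto simp: P_def)
  have left: "P vs ws * adjacency_matrix_wrt G ws
      = mat ?n ?n (\<lambda>(i, j). if vs ! i \<rightarrow>\<^bsub>G\<^esub> ws ! j then 1 else 0)"
  proof (rule eq_matI)
    fix i j assume "i < dim_row (mat ?n ?n (\<lambda>(i, j). if vs ! i \<rightarrow>\<^bsub>G\<^esub> ws ! j then 1 else 0 :: real))"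
      "j < dim_col (mat ?n ?n (\<lambda>(i, j). if vs ! i \<rightarrow>\<^bsub>G\<^esub> ws ! j then 1 else 0 :: real))"
    then have ij: "i < ?n" "j < ?n" by auto
    have mem: "vs ! i \<in> set ws"
      using nth_mem[of i vs] ij eq by simp
    have "(P vs ws * adjacency_matrix_wrt G ws) $$ (i, j)
        = (\<Sum>l = 0..<?n. (if vs ! i = ws ! l then 1 else 0) * (if ws ! l \<rightarrow>\<^bsub>G\<^esub> ws ! j then 1 else 0))"
      using ij by (simp add: P_def adjacency_matrix_wrt_def scalar_prod_def len)
    also have "\<dots> = (if vs ! i \<rightarrow>\<^bsub>G\<^esub> ws ! j then 1 else 0)"
      by (rule pick[OF ws len mem, where f = "\<lambda>y. if y \<rightarrow>\<^bsub>G\<^esub> ws ! j then 1 else 0"])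
    finally show "(P vs ws * adjacency_matrix_wrt G ws) $$ (i, j)
        = mat ?n ?n (\<lambda>(i, j). if vs ! i \<rightarrow>\<^bsub>G\<^esub> ws ! j then 1 else 0) $$ (i, j)"
      using ij by simp
  qed (auto simp: P_def adjacency_matrix_wrt_def len)
  have "adjacency_matrix_wrt G vs = P vs ws * adjacency_matrix_wrt G ws * P ws vs"
    unfolding left
  proof (rule eq_matI)
    fix i j
    assume "i < dim_row (mat ?n ?n (\<lambda>(i, j). if vs ! i \<rightarrow>\<^bsub>G\<^esub> ws ! j then 1 else 0) * P ws vs)"
      "j < dim_col (mat ?n ?n (\<lambda>(i, j). if vs ! i \<rightarrow>\<^bsub>G\<^esub> ws ! j then 1 else 0) * P ws vs)"
    then have ij: "i < ?n" "j < ?n" by (auto simp: P_def)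
    have mem: "vs ! j \<in> set ws"
      using nth_mem[of j vs] ij eq by simp
    have "(mat ?n ?n (\<lambda>(i, j). if vs ! i \<rightarrow>\<^bsub>G\<^esub> ws ! j then 1 else 0) * P ws vs) $$ (i, j)
        = (\<Sum>l = 0..<?n. (if vs ! j = ws ! l then 1 else 0) * (if vs ! i \<rightarrow>\<^bsub>G\<^esub> ws ! l then 1 else 0))"
      using ij by (auto simp: P_def scalar_prod_def intro!: sum.cong)
    also have "\<dots> = (if vs ! i \<rightarrow>\<^bsub>G\<^esub> vs ! j then 1 else 0)"
      by (rule pick[OF ws len mem, where f = "\<lambda>y. if vs ! i \<rightarrow>\<^bsub>G\<^esub> y then 1 else 0"])
    finally show "adjacency_matrix_wrt G vs $$ (i, j)
        = (mat ?n ?n (\<lambda>(i, j). if vs ! i \<rightarrow>\<^bsub>G\<^esub> ws ! j then 1 else 0) * P ws vs) $$ (i, j)"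
      using ij by (simp add: adjacency_matrix_wrt_def)
  qed (auto simp: P_def adjacency_matrix_wrt_def)
  moreover have "P vs ws * P ws vs = 1\<^sub>m ?n" "P ws vs * P vs ws = 1\<^sub>m ?n"
    using inv[of vs ws] inv[of ws vs] vs ws len eq by auto
  ultimately have "similar_mat_wit (adjacency_matrix_wrt G vs) (adjacency_matrix_wrt G ws)
      (P vs ws) (P ws vs)"
    by (auto simp: similar_mat_wit_def Let_def adjacency_matrix_wrt_def len P_def)
  then have "similar_mat (adjacency_matrix_wrt G vs) (adjacency_matrix_wrt G ws)"
    unfolding similar_mat_def by blast
  then show ?thesis by (rule char_poly_similar)
qed

lemma char_poly_adjacency_matrix:
  assumes "finite (verts G)" "distinct vs" "set vs = verts G"
  shows "char_poly (adjacency_matrix G) = char_poly (adjacency_matrix_wrt G vs)"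
  unfolding adjacency_matrix_def
  using assms vertex_enum[OF assms(1)] by (intro char_poly_adjacency_matrix_wrt) auto

end

theory Submission
  imports Defs "Jordan_Normal_Form.Schur_Decomposition" "HOL-Library.Disjoint_Sets"
begin

text \<open>
  Suppose that removing \<open>S\<close> leaves more than \<open>card S\<close> components. Each component sends at least one
  edge to \<open>S\<close>, and together they send at most \<open>k * card S\<close> edges, so at least two components send
  fewer than \<open>k\<close> edges. For each of these two, a test vector supported on the component shows that
  its Rayleigh quotient reaches the bound \<open>\<theta>\<close> of the theorem. The supports are disjoint and not joined by
  edges, so the quadratic form of the adjacency matrix is at least \<open>\<theta>\<close> times the squared norm on a
  plane, and \<open>\<lambda>\<^sub>2 \<ge> \<theta>\<close> by the min-max principle.
\<close>

section \<open>Real symmetric matrices\<close>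

text \<open>Complete \<open>v\<close> to a basis and apply Gram-Schmidt, which leaves the first
  vector unchanged; the columns of \<open>W\<close> are the resulting vectors divided by their
  lengths.\<close>

lemma orthogonal_matrix_first_column:
  fixes v :: "real vec"
  assumes v: "v \<in> carrier_vec n" and v0: "v \<noteq> 0\<^sub>v n"
  obtains W c where "W \<in> carrier_mat n n" "W\<^sup>T * W = 1\<^sub>m n" "col W 0 = c \<cdot>\<^sub>v v"
proof -
  interpret cof_vec_space n "TYPE(real)" .
  note b = basis_completion[OF v v0]
  have lin: "lin_indpt (set (basis_completion v))" and cb: "set (basis_completion v) \<subseteq> carrier_vec n"
    and db: "distinct (basis_completion v)" using b by auto
  define ws where "ws = gram_schmidt n (basis_completion v)"
  note gs = gram_schmidt_result[OF cb db lin ws_def]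
  have len: "length ws = n" using gs(4) b by simp
  have n: "n > 0" using v v0 by (cases n) auto
  obtain us where us: "basis_completion v = v # us"
    using b n by (cases "basis_completion v") auto
  have "hd ws = v" unfolding ws_def us by (rule gram_schmidt_hd[OF v])
  then have ws0: "ws ! 0 = v" using len n by (subst hd_conv_nth[symmetric]) auto
  have carr: "ws ! i \<in> carrier_vec n" if "i < n" for i
    using gs(3) len that nth_mem by blast
  have ip: "ws ! i \<bullet> ws ! j = 0 \<longleftrightarrow> i \<noteq> j" if "i < n" "j < n" for i j
    using corthogonalD[OF gs(2)] that len by simp
  define N where "N = (\<lambda>i. 1 / sqrt (ws ! i \<bullet> ws ! i))"
  define W where "W = mat n n (\<lambda>(k, i). N i * ws ! i $ k)"
  have "W\<^sup>T * W = 1\<^sub>m n"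
  proof (rule eq_matI)
    fix i j assume "i < dim_row (1\<^sub>m n :: real mat)" "j < dim_col (1\<^sub>m n :: real mat)"
    then have ij: "i < n" "j < n" by auto
    have "(W\<^sup>T * W) $$ (i, j) = (\<Sum>k = 0..<n. (N i * ws ! i $ k) * (N j * ws ! j $ k))"
      using ij by (simp add: W_def scalar_prod_def)
    also have "\<dots> = N i * N j * (ws ! i \<bullet> ws ! j)"
      using carr[OF ij(2)] by (simp add: scalar_prod_def sum_distrib_left algebra_simps)
    also have "\<dots> = (if i = j then 1 else 0)"
    proof (cases "i = j")
      case True
      have "ws ! i \<bullet> ws ! i \<ge> 0" by (simp add: scalar_prod_def sum_nonneg)
      moreover have "ws ! i \<bullet> ws ! i \<noteq> 0" using ip ij by blast
      ultimately show ?thesis using True by (simp add: N_def)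
    qed (use ip ij in simp)
    finally show "(W\<^sup>T * W) $$ (i, j) = 1\<^sub>m n $$ (i, j)" using ij by simp
  qed (auto simp: W_def)
  moreover have "col W 0 = N 0 \<cdot>\<^sub>v v"
    using n v by (intro eq_vecI) (auto simp: W_def ws0)
  moreover have "W \<in> carrier_mat n n" by (simp add: W_def)
  ultimately show ?thesis using that by blast
qed

text \<open>Deflation, by induction on the list of roots: an orthogonal \<open>W\<close> with an
  eigenvector for \<open>e\<close> as first column splits off the entry \<open>e\<close>, and the
  remaining block is again symmetric, with the remaining roots. The diagonal follows the order of
  \<open>es\<close>, so a descending list puts the largest eigenvalue first.\<close>

lemma real_symmetric_diagonalization:
  fixes A :: "real mat"
  assumes "A \<in> carrier_mat n n" "A\<^sup>T = A" "char_poly A = (\<Prod>e\<leftarrow>es. [:- e, 1:])"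
  obtains P where "P \<in> carrier_mat n n" "P\<^sup>T * P = 1\<^sub>m n"
    "P\<^sup>T * A * P = mat n n (\<lambda>(i, j). if i = j then es ! i else 0)"
  using assms
proof (induction es arbitrary: n A thesis)
  case Nil
  then have "n = 0" using degree_monic_char_poly[of A n] by simp
  then show ?case using Nil.prems(2) by (intro Nil.prems(1)[of "1\<^sub>m 0"]) auto
next
  case (Cons e es)
  note A = Cons.prems(2) and sym = Cons.prems(3)
  have "eigenvalue A e"
    unfolding eigenvalue_root_char_poly[OF A] Cons.prems(4) by simp
  then obtain v where v: "v \<in> carrier_vec n" "v \<noteq> 0\<^sub>v n" "A *\<^sub>v v = e \<cdot>\<^sub>v v"
    using A by (auto simp: eigenvalue_def eigenvector_def)
  obtain W c where W: "W \<in> carrier_mat n n" "W\<^sup>T * W = 1\<^sub>m n" and W0: "col W 0 = c \<cdot>\<^sub>v v"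
    using orthogonal_matrix_first_column[OF v(1,2)] .
  obtain m where n: "n = Suc m" using v by (cases n) auto
  have WW: "W * W\<^sup>T = 1\<^sub>m n"
    using mat_mult_left_right_inverse[of "W\<^sup>T" n W] W by simp
  define B where "B = W\<^sup>T * A * W"
  have B: "B \<in> carrier_mat n n" using A W by (simp add: B_def)
  have symB: "B\<^sup>T = B"
    unfolding B_def using A W sym by (simp add: transpose_mult[of _ n n _ n] assoc_mult_mat[of _ n n _ n _ n])
  \<comment> \<open>Column 0 of \<open>A * W\<close> is \<open>e\<close> times column 0 of
    \<open>W\<close>, and the columns of \<open>W\<close> are orthonormal. Symmetry of
    \<open>B\<close> then clears row 0 as well.\<close>
  have entry: "B $$ (i, 0) = (if i = 0 then e else 0)" if "i < n" for i
  proof -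
    have "A *\<^sub>v col W 0 = e \<cdot>\<^sub>v col W 0"
      unfolding W0 using A v by (simp add: mult_mat_vec smult_smult_assoc mult.commute)
    then have "col (A * W) 0 = e \<cdot>\<^sub>v col W 0"
      using col_mult2[OF A W(1), of 0] n by simp
    then have "B $$ (i, 0) = row (W\<^sup>T) i \<bullet> (e \<cdot>\<^sub>v col W 0)"
      unfolding B_def using assoc_mult_mat[of "W\<^sup>T" n n A n W n] A W that n by simp
    also have "\<dots> = e * (W\<^sup>T * W) $$ (i, 0)"
      using W(1) that n by (simp add: scalar_prod_smult_distrib[of _ n])
    also have "\<dots> = (if i = 0 then e else 0)" unfolding W(2) using that n by simp
    finally show ?thesis .
  qed
  have entry': "B $$ (0, i) = (if i = 0 then e else 0)" if "i < n" for i
    using entry[OF that] that n B symB by (metis carrier_matD index_transpose_mat(1) zero_less_Suc)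
  define A1 A3 where "A1 = mat 1 1 (\<lambda>_. e)" and "A3 = mat m m (\<lambda>(i, j). B $$ (Suc i, Suc j))"
  have A3: "A3 \<in> carrier_mat m m" by (simp add: A3_def)
  have block: "B = four_block_mat A1 (0\<^sub>m 1 m) (0\<^sub>m m 1) A3"
    using B entry entry' n by (intro eq_matI) (auto simp: A1_def A3_def)
  have symA3: "A3\<^sup>T = A3"
  proof (rule eq_matI)
    fix i j assume "i < dim_row A3" "j < dim_col A3"
    then have "i < m" "j < m" by (auto simp: A3_def)
    then have "B $$ (Suc j, Suc i) = B $$ (Suc i, Suc j)"
      using B symB n by (metis Suc_less_eq carrier_matD index_transpose_mat(1))
    then show "A3\<^sup>T $$ (i, j) = A3 $$ (i, j)" using \<open>i < m\<close> \<open>j < m\<close> by (simp add: A3_def)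
  qed (auto simp: A3_def)
  have "similar_mat_wit B A (W\<^sup>T) W"
    by (rule similar_mat_witI[of _ _ n]) (use W WW A B in \<open>auto simp: B_def\<close>)
  then have "char_poly B = char_poly A"
    by (intro char_poly_similar) (auto simp: similar_mat_def)
  moreover have "char_poly B = char_poly A1 * char_poly A3"
    unfolding block by (rule char_poly_four_block_zeros_col) (auto simp: A1_def A3_def)
  moreover have "char_poly A1 = [:- e, 1:]"
    by (simp add: A1_def char_poly_defs det_def sign_def)
  ultimately have "[:- e, 1:] * char_poly A3 = [:- e, 1:] * (\<Prod>e\<leftarrow>es. [:- e, 1:])"
    using Cons.prems(4) by (simp del: mult_pCons_left)
  then have "char_poly A3 = (\<Prod>e\<leftarrow>es. [:- e, 1:])"
    by (subst (asm) mult_cancel_left) simp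
  then obtain P where P: "P \<in> carrier_mat m m" "P\<^sup>T * P = 1\<^sub>m m"
    "P\<^sup>T * A3 * P = mat m m (\<lambda>(i, j). if i = j then es ! i else 0)"
    using Cons.IH[OF _ A3 symA3] by blast
  \<comment> \<open>Bordering \<open>P\<close> by a 1 keeps the entry \<open>e\<close> in place, so
    \<open>W * R\<close> diagonalizes \<open>A\<close>.\<close>
  define R where "R = four_block_mat (1\<^sub>m 1) (0\<^sub>m 1 m) (0\<^sub>m m 1) P"
  have R: "R \<in> carrier_mat n n" unfolding R_def n using four_block_carrier_mat[OF one_carrier_mat[of 1] P(1)] by simp
  have RT: "R\<^sup>T = four_block_mat (1\<^sub>m 1) (0\<^sub>m 1 m) (0\<^sub>m m 1) (P\<^sup>T)"
    unfolding R_def using P by (subst transpose_four_block_mat[of _ 1 1 _ m _ m]) auto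
  have RR: "R\<^sup>T * R = 1\<^sub>m n"
    unfolding RT unfolding R_def
    by (subst mult_four_block_mat[of _ 1 1 _ m _ m _ _ 1 _ m]) (use P n in auto)
  have "R\<^sup>T * B * R = four_block_mat A1 (0\<^sub>m 1 m) (0\<^sub>m m 1) (P\<^sup>T * A3 * P)"
    unfolding RT block unfolding R_def
    apply (subst mult_four_block_mat[of _ 1 1 _ m _ m _ _ 1 _ m])
    using P A3 apply (auto simp: A1_def)
    apply (subst mult_four_block_mat[of _ 1 1 _ m _ m _ _ 1 _ m])
    using P A3 apply (auto simp: A1_def)
    done
  also have "\<dots> = mat n n (\<lambda>(i, j). if i = j then (e # es) ! i else 0)"
    unfolding P(3) using n by (intro eq_matI) (auto simp: A1_def)
  finally have diag: "R\<^sup>T * B * R = mat n n (\<lambda>(i, j). if i = j then (e # es) ! i else 0)" .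
  show ?case
  proof (rule Cons.prems(1)[of "W * R"])
    show "W * R \<in> carrier_mat n n" using W R by simp
    have T: "(W * R)\<^sup>T = R\<^sup>T * W\<^sup>T" using W R by (simp add: transpose_mult)
    have "R\<^sup>T * W\<^sup>T * (W * R) = R\<^sup>T * (W\<^sup>T * W) * R"
      using W(1) R by (simp add: assoc_mult_mat[of _ n n _ n _ n])
    then show "(W * R)\<^sup>T * (W * R) = 1\<^sub>m n"
      unfolding T using W(2) R RR by simp
    have "R\<^sup>T * W\<^sup>T * A * (W * R) = R\<^sup>T * B * R"
      unfolding B_def using W(1) R A by (simp add: assoc_mult_mat[of _ n n _ n _ n])
    then show "(W * R)\<^sup>T * A * (W * R) = mat n n (\<lambda>(i, j). if i = j then (e # es) ! i else 0)"
      unfolding T using diag by simp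
  qed
qed

section \<open>Reality of the spectrum\<close>

text \<open>The Hermitian form \<open>s\<close> of \<open>A\<close> at an eigenvector equals its own
  conjugate, and it is also \<open>a\<close> times the squared norm, a positive real.\<close>

lemma real_symmetric_eigenvalue_real:
  fixes A :: "real mat" and a :: complex
  assumes A: "A \<in> carrier_mat n n" and sym: "A\<^sup>T = A"
    and ev: "eigenvalue (map_mat of_real A) a"
  shows "a \<in> \<real>"
proof -
  define C where "C = map_mat complex_of_real A"
  obtain v where v: "v \<in> carrier_vec n" "v \<noteq> 0\<^sub>v n" "C *\<^sub>v v = a \<cdot>\<^sub>v v"
    using ev A by (auto simp: eigenvalue_def eigenvector_def C_def)
  have sym': "A $$ (i, j) = A $$ (j, i)" if "i < n" "j < n" for i j
    using sym A that by (metis carrier_matD index_transpose_mat(1))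
  define s where "s = (\<Sum>i<n. \<Sum>j<n. cnj (v $ i) * A $$ (i, j) * v $ j)"
  have "cnj s = (\<Sum>i<n. \<Sum>j<n. cnj (v $ j) * A $$ (i, j) * v $ i)"
    by (simp add: s_def mult_ac)
  also have "\<dots> = (\<Sum>j<n. \<Sum>i<n. cnj (v $ j) * A $$ (i, j) * v $ i)"
    by (rule sum.swap)
  also have "\<dots> = s" unfolding s_def using sym' by (intro sum.cong) auto
  finally have s_real: "s \<in> \<real>" by (simp add: Reals_cnj_iff)
  have "(\<Sum>j<n. A $$ (i, j) * v $ j) = a * v $ i" if "i < n" for i
  proof -
    have "(C *\<^sub>v v) $ i = (\<Sum>j<n. A $$ (i, j) * v $ j)"
      using that A v(1) by (simp add: C_def scalar_prod_def lessThan_atLeast0)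
    then show ?thesis using v(1,3) that by simp
  qed
  then have "s = (\<Sum>i<n. cnj (v $ i) * (a * v $ i))"
    unfolding s_def by (simp add: sum_distrib_left mult.assoc flip: sum_distrib_left)
  also have "\<dots> = a * of_real (\<Sum>i<n. (cmod (v $ i))\<^sup>2)"
    by (simp add: sum_distrib_left complex_norm_square mult_ac flip: of_real_power)
  finally have "s = a * of_real (\<Sum>i<n. (cmod (v $ i))\<^sup>2)" .
  moreover define R where "R = (\<Sum>i<n. (cmod (v $ i))\<^sup>2)"
  ultimately have s: "s = a * of_real R" by simp
  obtain i where "i < n" "v $ i \<noteq> 0" using v(1,2) by (metis carrier_vecD eq_vecI index_zero_vec)
  then have "R > 0" unfolding R_def by (intro sum_pos2[of _ i]) auto
  then have "a = s / of_real R" using s by simp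
  then show ?thesis using s_real by simp
qed

text \<open>Over the complex numbers the polynomial splits, all roots are real, and the
  factorization descends because the embedding of the reals is injective. Hence the eigenvalue list
  is complete.\<close>

lemma real_symmetric_char_poly_splits:
  fixes A :: "real mat"
  assumes A: "A \<in> carrier_mat n n" and sym: "A\<^sup>T = A"
  shows "char_poly A = (\<Prod>e\<in>#proots (char_poly A). [:- e, 1:])"
    and "size (proots (char_poly A)) = n"
proof -
  interpret h: map_poly_inj_idom_hom complex_of_real ..
  define C where "C = map_mat complex_of_real A"
  have C: "C \<in> carrier_mat n n" using A by (simp add: C_def)
  obtain as where as: "char_poly C = (\<Prod>a\<leftarrow>as. [:- a, 1:])" "length as = n"
    using char_poly_factorized[OF C] by blast
  have "a \<in> \<real>" if "a \<in> set as" for a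
  proof -
    have "poly (char_poly C) a = 0" unfolding as(1) poly_prod_list using that
      by (force simp: prod_list_zero_iff)
    then show ?thesis
      using real_symmetric_eigenvalue_real[OF A sym] eigenvalue_root_char_poly[OF C] by (simp add: C_def)
  qed
  then have as_Re: "as = map (\<lambda>a. of_real (Re a)) as" by (simp add: map_idI)
  have "map_poly of_real (char_poly A) = char_poly C"
    unfolding C_def by (rule of_real_hom.char_poly_hom[OF A, symmetric])
  also have "\<dots> = map_poly of_real (\<Prod>e\<leftarrow>map Re as. [:- e, 1:])"
    unfolding as(1) by (subst as_Re) (simp add: h.hom_prod_list o_def)
  finally have split: "char_poly A = (\<Prod>e\<leftarrow>map Re as. [:- e, 1:])" by simp
  have "proots (\<Prod>e\<leftarrow>es. [:- e, 1:]) = mset es" for es :: "real list"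
  proof (induction es)
    case (Cons e es)
    have "(\<Prod>e\<leftarrow>es. [:- e, 1:]) \<noteq> (0 :: real poly)" by (auto simp: prod_list_zero_iff)
    then show ?case using Cons by (simp add: proots_mult del: mult_pCons_left)
  qed simp
  then have roots: "proots (char_poly A) = mset (map Re as)" unfolding split .
  show "char_poly A = (\<Prod>e\<in>#proots (char_poly A). [:- e, 1:])"
    unfolding roots by (subst split) (simp flip: prod_mset_prod_list add: image_mset.compositionality o_def)
  show "size (proots (char_poly A)) = n" unfolding roots using as(2) by simp
qed

section \<open>The min-max principle for the second eigenvalue\<close>

text \<open>A plane contains a direction orthogonal to the top eigenvector, and orthogonally to it
  no Rayleigh quotient exceeds the second eigenvalue. Nontriviality is expressed by the
  coefficients; disjoint supports later turn it into a nonzero norm.\<close>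

lemma second_eigenvalue_bound_on_plane:
  fixes A :: "real mat"
  assumes A: "A \<in> carrier_mat n n" and sym: "A\<^sup>T = A" and n: "n \<ge> 2"
    and u: "u \<in> carrier_vec n" and v: "v \<in> carrier_vec n"
  obtains a b where "a \<noteq> 0 \<or> b \<noteq> 0"
    "(a \<cdot>\<^sub>v u + b \<cdot>\<^sub>v v) \<bullet> (A *\<^sub>v (a \<cdot>\<^sub>v u + b \<cdot>\<^sub>v v)) \<le>
      rev (sorted_list_of_multiset (proots (char_poly A))) ! 1 *
      ((a \<cdot>\<^sub>v u + b \<cdot>\<^sub>v v) \<bullet> (a \<cdot>\<^sub>v u + b \<cdot>\<^sub>v v))"
proof -
  define es where "es = rev (sorted_list_of_multiset (proots (char_poly A)))"
  have mset: "mset es = proots (char_poly A)" by (simp add: es_def)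
  have len: "length es = n"
    using real_symmetric_char_poly_splits(2)[OF A sym] mset by (metis size_mset)
  have "char_poly A = (\<Prod>e\<leftarrow>es. [:- e, 1:])"
    using real_symmetric_char_poly_splits(1)[OF A sym] unfolding mset[symmetric]
    by (simp flip: prod_mset_prod_list)
  then obtain P where P: "P \<in> carrier_mat n n" "P\<^sup>T * P = 1\<^sub>m n"
    and diag: "P\<^sup>T * A * P = mat n n (\<lambda>(i, j). if i = j then es ! i else 0)"
    using real_symmetric_diagonalization[OF A sym] by blast
  have PP: "P * P\<^sup>T = 1\<^sub>m n"
    using mat_mult_left_right_inverse[of "P\<^sup>T" n P] P by simp
  \<comment> \<open>\<open>es\<close> is in descending order, so entry 1 dominates every entry
    except entry 0.\<close>
  have desc: "es ! i \<le> es ! 1" if "1 \<le> i" "i < n" for i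
    using that len sorted_rev_nth_mono[of es 1 i] by (simp add: es_def)
  \<comment> \<open>Choose a vector of the plane orthogonal to the eigenvector of the largest eigenvalue.\<close>
  define p q where "p = (P\<^sup>T *\<^sub>v u) $ 0" and "q = (P\<^sup>T *\<^sub>v v) $ 0"
  obtain a b :: real where ab: "a \<noteq> 0 \<or> b \<noteq> 0" "a * p + b * q = 0"
  proof (cases "p = 0")
    case True
    then show ?thesis using that[of 1 0] by simp
  next
    case False
    then show ?thesis using that[of "- q" p] by simp
  qed
  define x where "x = a \<cdot>\<^sub>v u + b \<cdot>\<^sub>v v"
  \<comment> \<open>\<open>y\<close> holds the coordinates of \<open>x\<close> in the eigenbasis;
    the choice of \<open>a\<close> and \<open>b\<close> makes coordinate 0 vanish.\<close>
  define y where "y = P\<^sup>T *\<^sub>v x"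
  have x: "x \<in> carrier_vec n" using u v by (simp add: x_def)
  have y: "y \<in> carrier_vec n" using P x by (simp add: y_def)
  have xy: "x = P *\<^sub>v y"
    unfolding y_def using P PP x by (simp flip: assoc_mult_mat_vec[of _ n n _ n])
  have y0: "y $ 0 = 0"
  proof -
    have "y = a \<cdot>\<^sub>v (P\<^sup>T *\<^sub>v u) + b \<cdot>\<^sub>v (P\<^sup>T *\<^sub>v v)"
      unfolding y_def x_def using P u v by (simp add: mult_add_distrib_mat_vec[of _ n n] mult_mat_vec[of _ n n])
    then show ?thesis using ab(2) P n by (simp add: p_def q_def)
  qed
  have adj: "(P *\<^sub>v y) \<bullet> w = y \<bullet> (P\<^sup>T *\<^sub>v w)" if "w \<in> carrier_vec n" for w
    using transpose_vec_mult_scalar[OF P(1) y that] P y that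
    by (metis comm_scalar_prod mult_mat_vec_carrier transpose_carrier_mat)
  have "x \<bullet> x = y \<bullet> y"
    using adj[OF x] by (simp add: xy[symmetric] y_def[symmetric])
  then have xx: "x \<bullet> x = (\<Sum>i<n. (y $ i)\<^sup>2)"
    using y by (simp add: scalar_prod_def lessThan_atLeast0 power2_eq_square)
  have "x \<bullet> (A *\<^sub>v x) = y \<bullet> (P\<^sup>T *\<^sub>v (A *\<^sub>v x))"
    using adj[of "A *\<^sub>v x"] A x xy by simp
  also have "P\<^sup>T *\<^sub>v (A *\<^sub>v x) = (P\<^sup>T * A * P) *\<^sub>v y"
    unfolding xy using P A y by (simp add: assoc_mult_mat_vec[of _ n n _ n])
  also have "y \<bullet> \<dots> = (\<Sum>i<n. es ! i * (y $ i)\<^sup>2)"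
  proof -
    have "((P\<^sup>T * A * P) *\<^sub>v y) $ i = es ! i * y $ i" if "i < n" for i
    proof -
      have "((P\<^sup>T * A * P) *\<^sub>v y) $ i = (\<Sum>j<n. (if i = j then es ! i else 0) * y $ j)"
        unfolding diag using that y by (simp add: scalar_prod_def lessThan_atLeast0)
      also have "\<dots> = (\<Sum>j<n. if j = i then es ! i * y $ i else 0)"
        by (rule sum.cong) auto
      finally show ?thesis using that by simp
    qed
    moreover have "dim_vec ((P\<^sup>T * A * P) *\<^sub>v y) = n" using P by simp
    ultimately show ?thesis
      by (simp add: scalar_prod_def lessThan_atLeast0 power2_eq_square mult_ac cong: sum.cong_simp)
  qed
  also have "\<dots> \<le> (\<Sum>i<n. es ! 1 * (y $ i)\<^sup>2)"
  proof (rule sum_mono)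
    fix i assume "i \<in> {..<n}"
    then show "es ! i * (y $ i)\<^sup>2 \<le> es ! 1 * (y $ i)\<^sup>2"
      using y0 desc[of i] by (cases "i = 0") (auto intro: mult_right_mono)
  qed
  also have "\<dots> = es ! 1 * (x \<bullet> x)" by (simp add: xx sum_distrib_left)
  finally show ?thesis using that[OF ab(1)] unfolding x_def es_def by blast
qed

section \<open>Edge counting in regular relations\<close>

text \<open>Ordered pairs are counted: for symmetric \<open>E\<close>, an edge inside
  \<open>H\<close> counts twice in \<open>arc_count E H H\<close>, an edge between disjoint sets
  once.\<close>

definition arc_count :: "('a \<Rightarrow> 'a \<Rightarrow> bool) \<Rightarrow> 'a set \<Rightarrow> 'a set \<Rightarrow> nat" where
  "arc_count E X Y = (\<Sum>x\<in>X. card {y \<in> Y. E x y})"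

lemma arc_count_sym:
  assumes "symp E" "finite X" "finite Y"
  shows "arc_count E X Y = arc_count E Y X"
proof -
  have "arc_count E X Y = (\<Sum>x\<in>X. \<Sum>y\<in>Y. if E x y then 1 else 0)"
    unfolding arc_count_def using assms(3) by (simp add: sum.If_cases Int_def)
  also have "\<dots> = (\<Sum>y\<in>Y. \<Sum>x\<in>X. if E x y then 1 else 0)"
    by (rule sum.swap)
  also have "\<dots> = (\<Sum>y\<in>Y. \<Sum>x\<in>X. if E y x then 1 else 0)"
    using assms(1) by (intro sum.cong refl) (auto dest: sympD)
  also have "\<dots> = arc_count E Y X"
    unfolding arc_count_def using assms(2) by (simp add: sum.If_cases Int_def)
  finally show ?thesis .
qed

text \<open>Handshake argument: a vertex added to \<open>H\<close> has no loop and contributes each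
  of its edges to \<open>H\<close> once from either end.\<close>

lemma even_arc_count_self:
  assumes "symp E" "irreflp E" "finite H"
  shows "even (arc_count E H H)"
  using assms(3)
proof (induction H rule: finite_induct)
  case (insert v H)
  have ins: "{y \<in> insert v H. E x y} = (if E x v then insert v {y \<in> H. E x y} else {y \<in> H. E x y})" for x
    by auto
  have "card {y \<in> insert v H. E x y} = card {y \<in> H. E x y} + (if E x v then 1 else 0)" for x
    unfolding ins using insert.hyps by auto
  moreover have "{x \<in> insert v H. E x v} = {x \<in> H. E x v}" using irreflpD[OF assms(2)] by auto
  ultimately have "arc_count E (insert v H) (insert v H)
      = card {y \<in> H. E v y} + (arc_count E H H + card {x \<in> H. E x v})"
    using insert.hyps irreflpD[OF assms(2)]
    by (simp add: arc_count_def sum.distrib sum.If_cases Int_def del: insert_iff)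
  moreover have "{x \<in> H. E x v} = {y \<in> H. E v y}" using assms(1) by (auto dest: sympD)
  ultimately show ?case using insert.IH by simp
qed (simp add: arc_count_def)

text \<open>Simple \<open>k\<close>-regular graphs seen through adjacency alone, so that edges are
  counted without arcs as objects. \<open>inV\<close> speaks of targets; symmetry covers
  sources.\<close>

locale regular_relation =
  fixes V :: "'a set" and E :: "'a \<Rightarrow> 'a \<Rightarrow> bool" and k :: nat
  assumes fin: "finite V" and sym: "symp E" and irrefl: "irreflp E"
    and inV: "E x y \<Longrightarrow> y \<in> V" and deg: "x \<in> V \<Longrightarrow> card {y \<in> V. E x y} = k"
begin

lemma inner_plus_outer:
  assumes "H \<subseteq> V"
  shows "arc_count E H H + arc_count E H (V - H) = k * card H"
proof -
  have "card {y \<in> H. E x y} + card {y \<in> V - H. E x y} = k" if "x \<in> H" for x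
  proof -
    have "{y \<in> V. E x y} = {y \<in> H. E x y} \<union> {y \<in> V - H. E x y}" using assms by auto
    then have "card {y \<in> V. E x y} = card {y \<in> H. E x y} + card {y \<in> V - H. E x y}"
      using fin finite_subset[OF assms fin] by (simp add: card_Un_disjnt disjnt_def Int_def)
    then show ?thesis using deg that assms by auto
  qed
  then show ?thesis by (simp add: arc_count_def flip: sum.distrib)
qed

text \<open>If \<open>H\<close> had n \<le> k vertices, each would have at least k - n + 1
  neighbours outside, and n (k - n + 1) - k = (n - 1) (k - n) is nonnegative.\<close>

lemma low_boundary_imp_large:
  assumes H: "H \<subseteq> V" "H \<noteq> {}" and low: "arc_count E H (V - H) < k"
  shows "card H \<ge> k + 1"
proof (rule ccontr)
  assume "\<not> ?thesis"
  then have n: "card H \<le> k" by simp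
  have fH: "finite H" using H fin finite_subset by blast
  have n1: "card H \<ge> 1" using H fH by (simp add: Suc_le_eq card_gt_0_iff)
  have "card {y \<in> H. E x y} \<le> card H - 1" if "x \<in> H" for x
    using card_mono[of "H - {x}" "{y \<in> H. E x y}"] fH that irreflpD[OF irrefl] by auto
  then have "arc_count E H H \<le> card H * (card H - 1)"
    unfolding arc_count_def using sum_bounded_above[of H "\<lambda>x. card {y \<in> H. E x y}" "card H - 1"] by simp
  then have "k * card H < card H * (card H - 1) + k"
    using inner_plus_outer[OF H(1)] low by linarith
  \<comment> \<open>These parameters remove all subtractions; the inequality collapses to
    \<open>a * b < 0\<close>.\<close>
  moreover obtain a b where "card H = a + 1" "k = a + 1 + b"
    using n n1 by (metis add.commute le_Suc_ex)
  ultimately show False by (simp add: algebra_simps)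
qed

text \<open>By the handshake argument the boundary has the parity of \<open>k * card H\<close>. For
  even \<open>k\<close> it is therefore even, differs from \<open>k - 1\<close>, and is at most
  \<open>k - 2\<close>; this gain separates the two cases of the theorem.\<close>

lemma low_boundary_parity:
  assumes H: "H \<subseteq> V" and low: "arc_count E H (V - H) < k"
  shows "arc_count E H (V - H) + (if odd k then 2 else 3) \<le> k + 1"
proof (cases "odd k")
  case False
  have "even (arc_count E H H)" using even_arc_count_self[OF sym irrefl] H fin finite_subset by blast
  then have "even (arc_count E H (V - H))"
    using inner_plus_outer[OF H] False by (metis even_add even_mult_iff)
  then have "arc_count E H (V - H) \<noteq> k - 1" using False low by auto
  then show ?thesis using low False by auto
qed (use low in auto)

end

section \<open>Quadratic forms of adjacency relations\<close>

text \<open>The adjacency form at the vector that is \<open>f\<close> on \<open>X\<close> and 0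
  elsewhere.\<close>

definition quad_form :: "('a \<Rightarrow> 'a \<Rightarrow> bool) \<Rightarrow> 'a set \<Rightarrow> ('a \<Rightarrow> real) \<Rightarrow> real" where
  "quad_form E X f = (\<Sum>x\<in>X. \<Sum>y\<in>X. if E x y then f x * f y else 0)"

lemma quad_form_const:
  assumes "finite X"
  shows "quad_form E X (\<lambda>_. c) = c\<^sup>2 * arc_count E X X"
  using assms by (simp add: quad_form_def arc_count_def sum.If_cases Int_def power2_eq_square sum_distrib_left mult.commute)

lemma quad_form_two_valued:
  assumes "symp E" "finite A" "finite B" "A \<inter> B = {}"
  shows "quad_form E (A \<union> B) (\<lambda>x. if x \<in> A then a else b)
    = a\<^sup>2 * arc_count E A A + 2 * a * b * arc_count E A B + b\<^sup>2 * arc_count E B B"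
proof -
  define f where "f = (\<lambda>x. if x \<in> A then a else b)"
  have part: "(\<Sum>x\<in>X. \<Sum>y\<in>Y. if E x y then f x * f y else 0) = c * d * arc_count E X Y"
    if "\<And>x. x \<in> X \<Longrightarrow> f x = c" "\<And>y. y \<in> Y \<Longrightarrow> f y = d" "finite Y" for X Y c d
  proof -
    have "(\<Sum>x\<in>X. \<Sum>y\<in>Y. if E x y then f x * f y else 0) = (\<Sum>x\<in>X. \<Sum>y\<in>Y. if E x y then c * d else 0)"
      using that(1,2) by (intro sum.cong) auto
    then show ?thesis using that(3)
      by (simp add: arc_count_def sum.If_cases Int_def sum_distrib_left mult.commute)
  qed
  have B: "f x = b" if "x \<in> B" for x using that assms(4) by (auto simp: f_def)
  have A: "f x = a" if "x \<in> A" for x using that by (simp add: f_def)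
  have "quad_form E (A \<union> B) f
      = (\<Sum>x\<in>A. \<Sum>y\<in>A. if E x y then f x * f y else 0) + (\<Sum>x\<in>A. \<Sum>y\<in>B. if E x y then f x * f y else 0)
      + ((\<Sum>x\<in>B. \<Sum>y\<in>A. if E x y then f x * f y else 0) + (\<Sum>x\<in>B. \<Sum>y\<in>B. if E x y then f x * f y else 0))"
    unfolding quad_form_def using assms(2-4) by (simp add: sum.union_disjoint sum.distrib)
  also have "\<dots> = a\<^sup>2 * arc_count E A A + 2 * a * b * arc_count E A B + b\<^sup>2 * arc_count E B B"
    using part[OF A A assms(2)] part[OF A B assms(3)] part[OF B A assms(2)] part[OF B B assms(3)]
      arc_count_sym[OF assms(1-3)]
    by (simp add: power2_eq_square)
  finally show ?thesis unfolding f_def .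
qed

section \<open>Test vectors on sets with small boundary\<close>

context regular_relation begin

text \<open>
  For \<open>m = 2\<close> and \<open>m = 3\<close>, \<open>\<theta>\<close> is the bound of the theorem for odd and even \<open>k\<close>; it is the larger
  root of \<open>x\<^sup>2 - (k - 2) x - (k - 1 + m)\<close>.
\<close>

lemma low_boundary_test_vector:
  fixes \<theta> :: real
  assumes H: "H \<subseteq> V" and m: "m \<ge> 1" and bd: "arc_count E H (V - H) + m \<le> k + 1"
    and large: "card H \<ge> k + 1"
  defines "\<theta> \<equiv> (real k - 2 + sqrt (real k ^ 2 + 4 * real m)) / 2"
  shows "\<exists>f. (\<Sum>x\<in>H. (f x)\<^sup>2) > 0 \<and> quad_form E H f \<ge> \<theta> * (\<Sum>x\<in>H. (f x)\<^sup>2)"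
proof -
  define l where "l = arc_count E H (V - H)"
  have fH: "finite H" using H fin finite_subset by blast
  define w where "w = sqrt (real k ^ 2 + 4 * real m)"
  have w: "w = 2 * \<theta> - (real k - 2)" unfolding \<theta>_def w_def by (simp add: field_simps)
  have "w\<^sup>2 = real k ^ 2 + 4 * real m" unfolding w_def by (rule real_sqrt_pow2) simp
  then have \<theta>: "\<theta>\<^sup>2 = (real k - 2) * \<theta> + real k - 1 + real m"
    unfolding w by (simp add: power2_eq_square algebra_simps)
  have "real k \<le> w" unfolding w_def by (rule real_le_rsqrt) simp
  then have \<theta>_ge: "\<theta> \<ge> real k - 1" using w by simp
  have mk: "m \<le> k + 1" using bd by simp
  have inner: "real (arc_count E H H) = real k * card H - l"
    using inner_plus_outer[OF H] unfolding l_def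
    by (metis add_diff_cancel_right' of_nat_add of_nat_mult)
  show ?thesis
  proof (cases "card H = k + 1")
    \<comment> \<open>The constant vector suffices here: its Rayleigh quotient is the average inner
      degree \<open>k - l / card H\<close>, which is smallest for \<open>card H = k + 2\<close> and
      \<open>l = k + 1 - m\<close>.\<close>
    case False
    then have n: "card H \<ge> k + 2" using large by simp
    have "\<theta> * card H \<le> quad_form E H (\<lambda>_. 1)"
    proof -
      \<comment> \<open>\<open>k - 1 + y\<close> is that smallest average inner degree.\<close>
      define y where "y = (real m + 1) / (real k + 2)"
      have "real k * (real m + 1) * (real k + 2) + (real m + 1)\<^sup>2 - real m * (real k + 2)\<^sup>2 = (real k - real m + 1)\<^sup>2"
        by (simp add: power2_eq_square algebra_simps)
      \<comment> \<open>The denominator stays an atom \<open>K\<close> while it is cleared.\<close>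
      moreover have "a * ((c + 1) / K) + ((c + 1) / K)\<^sup>2 - c = (a * (c + 1) * K + (c + 1)\<^sup>2 - c * K\<^sup>2) / K\<^sup>2"
        if "K \<noteq> 0" for a c K :: real
        using that by (simp add: field_simps power2_eq_square)
      then have "real k * y + y\<^sup>2 - real m
          = (real k * (real m + 1) * (real k + 2) + (real m + 1)\<^sup>2 - real m * (real k + 2)\<^sup>2) / (real k + 2)\<^sup>2"
        unfolding y_def by (metis add_nonneg_pos less_irrefl of_nat_0_le_iff zero_less_numeral)
      ultimately have "real k * y + y\<^sup>2 - real m = (real k - real m + 1)\<^sup>2 / (real k + 2)\<^sup>2" by simp
      then have y: "real k * y + y\<^sup>2 \<ge> real m" by (metis diff_ge_0_iff_ge divide_nonneg_nonneg zero_le_power2)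
      have y0: "y \<ge> 0" by (simp add: y_def)
      have "\<theta> \<le> real k - 1 + y"
      proof (rule ccontr)
        assume "\<not> ?thesis"
        then have less: "real k - 1 + y < \<theta>" by simp
        \<comment> \<open>\<open>d\<close> is a nonnegative solution of
          \<open>t * (t + k) = m\<close>. Since \<open>t * (t + k)\<close> increases for
          \<open>t \<ge> 0\<close> and is at least \<open>m\<close> at \<open>y\<close>,
          \<open>y < d\<close> is impossible.\<close>
        define d where "d = \<theta> - (real k - 1)"
        have "d * (d + real k) = real m" using \<theta> by (simp add: d_def power2_eq_square algebra_simps)
        moreover have "y * (y + real k) < d * (d + real k)"
          using less y0 by (intro mult_strict_mono') (auto simp: d_def)
        ultimately show False using y by (simp add: power2_eq_square algebra_simps)
      qed
      also have "\<dots> = real k - (real k + 1 - real m) / (real k + 2)"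
        by (simp add: y_def field_simps)
      finally have "\<theta> * card H \<le> (real k - (real k + 1 - real m) / (real k + 2)) * card H"
        by (rule mult_right_mono) simp
      also have "\<dots> = real k * card H - (real k + 1 - real m) * (card H / (real k + 2))"
        by (simp add: algebra_simps)
      also have "\<dots> \<le> real k * card H - (real k + 1 - real m) * 1"
      proof -
        have "1 \<le> real (card H) / (real k + 2)" using n by simp
        then have "(real k + 1 - real m) * 1 \<le> (real k + 1 - real m) * (card H / (real k + 2))"
          using mk by (intro mult_left_mono) auto
        then show ?thesis by simp
      qed
      also have "\<dots> \<le> real k * card H - l" using bd unfolding l_def by simp
      also have "\<dots> = quad_form E H (\<lambda>_. 1)" using quad_form_const[OF fH, of E 1] inner by simp
      finally show ?thesis .
    qed
    then show ?thesis using n by (intro exI[of _ "\<lambda>_. 1"]) simp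
  next
    \<comment> \<open>At least \<open>m\<close> vertices of \<open>H\<close> have no neighbour outside \<open>H\<close> and are thus adjacent to all of \<open>H\<close>.
      The test vector is the eigenvector, for \<open>\<theta>\<close>, of the quotient matrix
      \<open>((m - 1, r), (m, r - 2))\<close> of the extremal case: \<open>m\<close> such vertices, and the other
      \<open>r = k + 1 - m\<close> each missing one neighbour in \<open>H\<close>.\<close>
    case n: True
    define D where "D = {x \<in> H. card {y \<in> H. E x y} = k}"
    have degH: "card {y \<in> H. E x y} \<le> k" if "x \<in> H" for x
      using card_mono[of "{y \<in> V. E x y}" "{y \<in> H. E x y}"] deg[of x] that H fin by auto
    \<comment> \<open>Every vertex of \<open>H - D\<close> sends an arc out of \<open>H\<close>. So
      \<open>H - D\<close> has at most \<open>l \<le> k + 1 - m\<close> elements, which leaves at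
      least \<open>m\<close> for \<open>D\<close>.\<close>
    have "(\<Sum>x\<in>H. card {y \<in> H. E x y} + (if x \<in> D then 0 else 1)) \<le> (\<Sum>x\<in>H. k)"
    proof (rule sum_mono)
      fix x assume "x \<in> H"
      then show "card {y \<in> H. E x y} + (if x \<in> D then 0 else 1) \<le> k"
        using degH[of x] by (auto simp: D_def)
    qed
    then have "arc_count E H H + card (H - D) \<le> k * card H"
      using fH by (simp add: sum.distrib arc_count_def sum.If_cases Diff_eq mult.commute)
    then have "card (H - D) \<le> l" using inner_plus_outer[OF H] l_def by linarith
    moreover have "card (H - D) = card H - card D" by (rule card_Diff_subset) (auto simp: D_def fH)
    ultimately have "m \<le> card D" using bd n unfolding l_def by linarith
    then obtain A where A: "A \<subseteq> D" "card A = m" by (rule obtain_subset_with_card_n)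
    have AH: "A \<subseteq> H" using A by (auto simp: D_def)
    have fA: "finite A" using AH fH finite_subset by blast
    \<comment> \<open>\<open>x\<close> has \<open>k\<close> neighbours in \<open>H\<close>, and
      \<open>H - {x}\<close> has exactly \<open>k\<close> elements.\<close>
    have full: "E x y \<longleftrightarrow> x \<noteq> y" if "x \<in> A" "y \<in> H" for x y
    proof -
      have sub: "{z \<in> H. E x z} \<subseteq> H - {x}" using irreflpD[OF irrefl] by auto
      have card: "card {z \<in> H. E x z} = card (H - {x})"
        using that A AH n fH by (auto simp: D_def)
      have "{z \<in> H. E x z} = H - {x}" by (rule card_subset_eq[OF _ sub card]) (simp add: fH)
      then show ?thesis using that by auto
    qed
    define r where "r = real k + 1 - real m"
    have r0: "r \<ge> 0" using mk by (simp add: r_def)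
    define B where "B = H - A"
    have fB: "finite B" and HAB: "H = A \<union> B" and dAB: "A \<inter> B = {}"
      using fH AH by (auto simp: B_def)
    have cB: "real (card B) = r"
      using card_Diff_subset[OF fA AH] A n mk by (simp add: B_def r_def of_nat_diff)
    have pAA: "real (arc_count E A A) = real m * (real m - 1)"
    proof -
      have "{y \<in> A. E x y} = A - {x}" if "x \<in> A" for x using full that AH by auto
      then have "arc_count E A A = m * (m - 1)" using A fA by (simp add: arc_count_def)
      then show ?thesis using m by (simp add: of_nat_diff)
    qed
    have pAB: "real (arc_count E A B) = real m * r"
    proof -
      have "{y \<in> B. E x y} = B" if "x \<in> A" for x using full that by (auto simp: B_def)
      then have "arc_count E A B = m * card B" using A by (simp add: arc_count_def)
      then show ?thesis using cB by simp
    qed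
    have form: "quad_form E H (\<lambda>x. if x \<in> A then a else b)
        = a\<^sup>2 * (real m * (real m - 1)) + 2 * a * b * (real m * r) + b\<^sup>2 * arc_count E B B" for a b
      unfolding HAB quad_form_two_valued[OF sym fA fB dAB] pAA pAB ..
    have k_eq: "real k = real m + r - 1" by (simp add: r_def)
    \<comment> \<open>Evaluating the form at the constant vector 1 both on \<open>H\<close> as a
      whole and blockwise isolates the arcs inside \<open>B\<close>.\<close>
    have "real (arc_count E B B) = r * (r - 1) - l"
    proof -
      have "real (arc_count E H H) = real m * (real m - 1) + 2 * (real m * r) + arc_count E B B"
        using form[of 1 1] quad_form_const[OF fH, of E 1] by simp
      moreover have "real (arc_count E H H) = (real m + r - 1) * (real m + r) - l"
        using inner n k_eq by simp
      ultimately show ?thesis by (simp add: algebra_simps)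
    qed
    moreover have "l \<le> r" using bd unfolding l_def r_def by simp
    ultimately have pBB: "real (arc_count E B B) \<ge> r * (r - 2)" by (simp add: algebra_simps)
    \<comment> \<open>With \<open>b = m\<close> the second row of the eigenvector equation
      determines \<open>a\<close>; the first row is then the quadratic equation of
      \<open>\<theta>\<close>.\<close>
    define a b where "a = \<theta> - r + 2" and "b = real m"
    define f where "f = (\<lambda>x. if x \<in> A then a else b)"
    have norm: "(\<Sum>x\<in>H. (f x)\<^sup>2) = real m * a\<^sup>2 + r * b\<^sup>2"
      unfolding HAB using fA fB dAB A cB
      by (subst sum.union_disjoint) (auto simp: f_def B_def intro!: sum.cong)
    have a0: "a > 0" using \<theta>_ge m by (simp add: a_def r_def)
    have e1: "(real m - 1) * a + r * b = \<theta> * a"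
      using \<theta> unfolding a_def b_def r_def by (simp add: power2_eq_square algebra_simps)
    have e2: "real m * a + (r - 2) * b = \<theta> * b"
      unfolding a_def b_def by (simp add: algebra_simps)
    have "\<theta> * (real m * a\<^sup>2 + r * b\<^sup>2) = real m * a * (\<theta> * a) + r * b * (\<theta> * b)"
      by (simp add: power2_eq_square algebra_simps)
    also have "\<dots> = a\<^sup>2 * (real m * (real m - 1)) + 2 * a * b * (real m * r) + b\<^sup>2 * (r * (r - 2))"
      unfolding e1[symmetric] e2[symmetric] by (simp add: power2_eq_square algebra_simps)
    also have "\<dots> \<le> quad_form E H f"
      unfolding f_def form using pBB by (simp add: mult_left_mono)
    finally have "\<theta> * (\<Sum>x\<in>H. (f x)\<^sup>2) \<le> quad_form E H f" by (simp only: norm)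
    moreover have "(\<Sum>x\<in>H. (f x)\<^sup>2) > 0"
      unfolding norm using a0 m r0 by (intro add_pos_nonneg) auto
    ultimately show ?thesis by blast
  qed
qed

section \<open>Counting arcs into the removed set\<close>

text \<open>Otherwise all parts but one send at least \<open>k\<close> arcs to \<open>S\<close>, and
  the last one sends at least one by connectivity. That is more than
  \<open>k * (card C - 1) \<ge> k * card S\<close>, yet \<open>S\<close> can receive at most
  \<open>k * card S\<close>.\<close>

lemma two_low_boundary_parts:
  assumes S: "S \<subseteq> V" and C: "\<Union>C = V - S" "disjoint C" "{} \<notin> C" "card C \<ge> 2" "card S < card C"
    and sep: "\<And>H x y. H \<in> C \<Longrightarrow> x \<in> H \<Longrightarrow> E x y \<Longrightarrow> y \<in> H \<union> S"
    and conn: "\<And>H. H \<subseteq> V \<Longrightarrow> H \<noteq> {} \<Longrightarrow> H \<noteq> V \<Longrightarrow> arc_count E H (V - H) > 0"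
  shows "\<exists>H1\<in>C. \<exists>H2\<in>C. H1 \<noteq> H2 \<and> arc_count E H1 (V - H1) < k \<and> arc_count E H2 (V - H2) < k"
proof (rule ccontr)
  assume neg: "\<not> ?thesis"
  have one: "H1 = H2" if "H1 \<in> C" "H2 \<in> C" "arc_count E H1 (V - H1) < k" "arc_count E H2 (V - H2) < k" for H1 H2
    using neg that by blast
  have fC: "finite C" using C(4) by (metis card.infinite not_numeral_le_zero)
  have sub: "H \<subseteq> V - S" if "H \<in> C" for H using C(1) that by blast
  have fS: "finite S" using S fin finite_subset by blast
  have fH: "finite H" if "H \<in> C" for H using sub[OF that] fin by (meson Diff_subset finite_subset)
  have "C \<noteq> {}" using C(4) by auto
  \<comment> \<open>\<open>H0\<close> is the exceptional part if there is one, and any part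
    otherwise.\<close>
  then obtain H0 where H0: "H0 \<in> C" "\<And>H. H \<in> C \<Longrightarrow> H \<noteq> H0 \<Longrightarrow> arc_count E H (V - H) \<ge> k"
    using one by (metis all_not_in_conv not_le)
  have "C - {H0} \<noteq> {}"
  proof
    assume "C - {H0} = {}"
    then have "card C \<le> card {H0}" by (intro card_mono) auto
    then show False using C(4) by simp
  qed
  then obtain H' where H': "H' \<in> C" "H' \<noteq> H0" by blast
  have "H' \<inter> H0 = {}" using C(2) H' H0(1) by (simp add: pairwise_def disjnt_def)
  moreover have "H' \<noteq> {}" "H0 \<noteq> {}" using C(3) H'(1) H0(1) by auto
  ultimately have "H0 \<noteq> V" using sub[OF H'(1)] by auto
  then have "arc_count E H0 (V - H0) > 0"
    using sub[OF H0(1)] \<open>H0 \<noteq> {}\<close> by (intro conn) auto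
  moreover have "k * (card C - 1) \<le> (\<Sum>H\<in>C - {H0}. arc_count E H (V - H))"
    using sum_bounded_below[of "C - {H0}" k "\<lambda>H. arc_count E H (V - H)"] H0 fC by (auto simp: mult.commute)
  moreover have "(\<Sum>H\<in>C. arc_count E H (V - H)) = arc_count E H0 (V - H0) + (\<Sum>H\<in>C - {H0}. arc_count E H (V - H))"
    using fC H0(1) by (rule sum.remove)
  ultimately have lower: "k * (card C - 1) < (\<Sum>H\<in>C. arc_count E H (V - H))" by linarith
  \<comment> \<open>Arcs leaving a part can only end in \<open>S\<close>.\<close>
  have "arc_count E H (V - H) = arc_count E H S" if "H \<in> C" for H
  proof -
    have "{y \<in> V - H. E x y} = {y \<in> S. E x y}" if "x \<in> H" for x
      using sep[OF \<open>H \<in> C\<close> that] sub[OF \<open>H \<in> C\<close>] S inV by blast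
    then show ?thesis by (simp add: arc_count_def)
  qed
  then have "(\<Sum>H\<in>C. arc_count E H (V - H)) = (\<Sum>H\<in>C. \<Sum>x\<in>H. card {y \<in> S. E x y})"
    by (simp add: arc_count_def)
  also have "\<dots> = arc_count E (\<Union>C) S"
    unfolding arc_count_def using fH C(2)
    by (subst sum.Union_disjoint) (auto simp: pairwise_def disjnt_def)
  also have "\<dots> = arc_count E S (V - S)"
    unfolding C(1) using sym fin fS by (intro arc_count_sym) auto
  also have "\<dots> \<le> k * card S" using inner_plus_outer[OF S] by linarith
  also have "\<dots> \<le> k * (card C - 1)" using C(5) by (intro mult_left_mono) auto
  finally show False using lower by simp
qed

end

section \<open>Combining test vectors with separated supports\<close>

text \<open>All mixed terms vanish: in the form because no arc joins the supports, in the norm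
  because the supports are disjoint.\<close>

lemma quad_form_two_separated:
  fixes f1 f2 :: "'a \<Rightarrow> real"
  assumes "finite V" "H1 \<subseteq> V" "H2 \<subseteq> V" "H1 \<inter> H2 = {}" "symp E"
    and sep: "\<And>x y. x \<in> H1 \<Longrightarrow> y \<in> H2 \<Longrightarrow> \<not> E x y"
  defines "g \<equiv> \<lambda>a b x. a * (if x \<in> H1 then f1 x else 0) + b * (if x \<in> H2 then f2 x else (0::real))"
  shows "quad_form E V (g a b) = a\<^sup>2 * quad_form E H1 f1 + b\<^sup>2 * quad_form E H2 f2"
    and "(\<Sum>x\<in>V. (g a b x)\<^sup>2) = a\<^sup>2 * (\<Sum>x\<in>H1. (f1 x)\<^sup>2) + b\<^sup>2 * (\<Sum>x\<in>H2. (f2 x)\<^sup>2)"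
proof -
  have sep': "\<not> E y x" if "x \<in> H1" "y \<in> H2" for x y using sep that assms(5) by (auto dest: sympD)
  have summand: "(if E x y then g a b x * g a b y else 0)
      = (if x \<in> H1 then if y \<in> H1 then a\<^sup>2 * (if E x y then f1 x * f1 y else 0) else 0 else 0)
      + (if x \<in> H2 then if y \<in> H2 then b\<^sup>2 * (if E x y then f2 x * f2 y else 0) else 0 else 0)" for x y
    using sep[of x y] sep'[of y x] assms(4) by (auto simp: g_def power2_eq_square)
  have res: "(\<Sum>x\<in>V. if x \<in> H then h x else 0) = sum h H" if "H \<subseteq> V" for H and h :: "'a \<Rightarrow> real"
    using assms(1) that by (simp add: sum.If_cases Int_absorb1)
  have res2: "(\<Sum>x\<in>V. \<Sum>y\<in>V. if x \<in> H then if y \<in> H then h x y else 0 else 0) = (\<Sum>x\<in>H. \<Sum>y\<in>H. h x y)"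
    if "H \<subseteq> V" for H and h :: "'a \<Rightarrow> 'a \<Rightarrow> real"
  proof -
    have "(\<Sum>y\<in>V. if x \<in> H then if y \<in> H then h x y else 0 else 0) = (if x \<in> H then \<Sum>y\<in>H. h x y else 0)" for x
      using res[OF that] by simp
    then show ?thesis using res[OF that] by simp
  qed
  show "quad_form E V (g a b) = a\<^sup>2 * quad_form E H1 f1 + b\<^sup>2 * quad_form E H2 f2"
    unfolding quad_form_def summand sum.distrib res2[OF assms(2)] res2[OF assms(3)]
    by (simp add: sum_distrib_left)
  have "(g a b x)\<^sup>2 = (if x \<in> H1 then a\<^sup>2 * (f1 x)\<^sup>2 else 0) + (if x \<in> H2 then b\<^sup>2 * (f2 x)\<^sup>2 else 0)" for x
    using assms(4) by (auto simp: g_def power_mult_distrib)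
  then show "(\<Sum>x\<in>V. (g a b x)\<^sup>2) = a\<^sup>2 * (\<Sum>x\<in>H1. (f1 x)\<^sup>2) + b\<^sup>2 * (\<Sum>x\<in>H2. (f2 x)\<^sup>2)"
    by (simp add: sum.distrib res[OF assms(2)] res[OF assms(3)] sum_distrib_left)
qed

section \<open>Graphs\<close>

text \<open>Without multiple arcs, \<open>head\<close> maps the arcs leaving a vertex bijectively to
  its neighbours, so the out-degree counts neighbours.\<close>

lemma graph_regular_relation:
  assumes "Digraph.graph G" "regular G k"
  shows "regular_relation (verts G) (\<lambda>x y. x \<rightarrow>\<^bsub>G\<^esub> y) k"
proof -
  interpret Digraph.graph G by (rule assms)
  show ?thesis
  proof
    show "symp (\<lambda>x y. x \<rightarrow>\<^bsub>G\<^esub> y)" by (intro sympI) (rule graph_symmetric)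
    show "irreflp (\<lambda>x y. x \<rightarrow>\<^bsub>G\<^esub> y)" by (intro irreflpI) (use adj_not_same in blast)
    show "y \<in> verts G" if "x \<rightarrow>\<^bsub>G\<^esub> y" for x y using adj_in_verts that by blast
  next
    fix x assume x: "x \<in> verts G"
    have "{y \<in> verts G. x \<rightarrow>\<^bsub>G\<^esub> y} = head G ` out_arcs G x"
      by (auto simp: arcs_ends_def arc_to_ends_def)
    moreover have "inj_on (head G) (out_arcs G x)"
      by (intro inj_onI no_multi_arcs) (auto simp: arc_to_ends_def)
    ultimately have "card {y \<in> verts G. x \<rightarrow>\<^bsub>G\<^esub> y} = out_degree G x"
      by (simp add: out_degree_def card_image)
    then show "card {y \<in> verts G. x \<rightarrow>\<^bsub>G\<^esub> y} = k" using assms(2) x by (simp add: regular_def)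
  qed simp
qed

text \<open>A set without outgoing arcs is closed under reachability, and in a connected graph every
  vertex is reachable from it.\<close>

lemma connected_boundary_pos:
  assumes "Digraph.graph G" "Digraph_Component.connected G"
    and H: "H \<subseteq> verts G" "H \<noteq> {}" "H \<noteq> verts G"
  shows "arc_count (\<lambda>x y. x \<rightarrow>\<^bsub>G\<^esub> y) H (verts G - H) > 0"
proof (rule ccontr)
  assume neg: "\<not> ?thesis"
  interpret Digraph.graph G by (rule assms)
  have "finite H" using finite_subset[OF H(1)] by simp
  then have "{y \<in> verts G - H. x \<rightarrow>\<^bsub>G\<^esub> y} = {}" if "x \<in> H" for x
    using neg that by (auto simp: arc_count_def card_eq_0_iff)
  then have closed: "y \<in> H" if "x \<in> H" "x \<rightarrow>\<^bsub>G\<^esub> y" for x y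
    using that adj_in_verts(2)[OF that(2)] by blast
  obtain u v where uv: "u \<in> H" "v \<in> verts G - H" using H by blast
  have "strongly_connected G"
    using symmetric_connected_imp_strongly_connected[OF sym_arcs assms(2)] .
  then have "u \<rightarrow>\<^sup>*\<^bsub>G\<^esub> v" using uv H(1) by (auto simp: strongly_connected_def)
  then have "v \<in> H" by (induction rule: reachable_induct) (use uv closed in auto)
  then show False using uv by simp
qed

text \<open>For the last claim: an edge between kept vertices survives in the induced graph in both
  directions, so its ends are mutually reachable and share a component.\<close>

lemma induced_components:
  assumes "Digraph.graph G" "S \<subseteq> verts G"
  defines "C \<equiv> pre_digraph.sccs_verts (G \<restriction> (verts G - S))"
  shows "\<Union>C = verts G - S" "disjoint C" "{} \<notin> C"
    "card C = num_components (G \<restriction> (verts G - S))"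
    "\<And>H x y. H \<in> C \<Longrightarrow> x \<in> H \<Longrightarrow> x \<rightarrow>\<^bsub>G\<^esub> y \<Longrightarrow> y \<in> H \<union> S"
proof -
  interpret Digraph.graph G by (rule assms)
  interpret I: wf_digraph "G \<restriction> (verts G - S)" by (rule wellformed_induce_subgraph)
  show "\<Union>C = verts G - S"
    unfolding C_def I.sccs_verts_conv_scc_of
    using I.in_scc_of_self I.sccs_verts_subsets I.scc_of_in_sccs_verts by fastforce
  then have sub: "H \<subseteq> verts G - S" if "H \<in> C" for H using that by blast
  show "disjoint C"
    unfolding C_def by (intro disjointI) (rule I.sccs_verts_disjoint)
  show "{} \<notin> C" unfolding C_def by (simp add: I.in_sccs_verts_conv_reachable)
  show "card C = num_components (G \<restriction> (verts G - S))"
    unfolding C_def num_components_def by (rule I.card_sccs_verts)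
  fix H x y assume H: "H \<in> C" and x: "x \<in> H" and xy: "x \<rightarrow>\<^bsub>G\<^esub> y"
  show "y \<in> H \<union> S"
  proof (rule ccontr)
    assume y: "y \<notin> H \<union> S"
    have mem: "x \<in> verts G - S" "y \<in> verts G - S"
      using sub[OF H] x y adj_in_verts(2)[OF xy] by auto
    have ind: "u \<rightarrow>\<^bsub>G \<restriction> X\<^esub> v" if uv: "u \<in> X" "v \<in> X" "u \<rightarrow>\<^bsub>G\<^esub> v" for u v X
    proof -
      obtain e where "e \<in> arcs G" "tail G e = u" "head G e = v"
        using uv(3) by (auto simp: arcs_ends_def arc_to_ends_def)
      then show ?thesis
        unfolding arcs_ends_def arc_to_ends_def using uv(1,2) by (intro image_eqI[of _ _ e]) auto
    qed
    have "x \<rightarrow>\<^sup>*\<^bsub>G \<restriction> (verts G - S)\<^esub> y"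
      by (rule I.reachable_adjI[OF ind[OF mem xy]])
    moreover have "y \<rightarrow>\<^sup>*\<^bsub>G \<restriction> (verts G - S)\<^esub> x"
      by (rule I.reachable_adjI[OF ind[OF mem(2,1) graph_symmetric[OF xy]]])
    moreover have "\<forall>u\<in>H. \<forall>v. v \<notin> H \<longrightarrow>
        \<not> u \<rightarrow>\<^sup>*\<^bsub>G \<restriction> (verts G - S)\<^esub> v \<or> \<not> v \<rightarrow>\<^sup>*\<^bsub>G \<restriction> (verts G - S)\<^esub> u"
      using H unfolding C_def I.in_sccs_verts_conv_reachable by (elim conjE)
    ultimately show False using x y by simp
  qed
qed

text \<open>On the plane spanned by the zero extensions of \<open>f1\<close> and \<open>f2\<close>
  the form is at least \<open>\<theta>\<close> times the squared norm; the min-max principle gives a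
  vector of it where the form is at most \<open>lambda2 G\<close> times the squared norm.\<close>

lemma lambda2_ge_of_separated_test_vectors:
  fixes \<theta> :: real
  assumes G: "Digraph.graph G" "card (verts G) \<ge> 2"
    and H: "H1 \<subseteq> verts G" "H2 \<subseteq> verts G" "H1 \<inter> H2 = {}"
    and sep: "\<And>x y. x \<in> H1 \<Longrightarrow> y \<in> H2 \<Longrightarrow> \<not> x \<rightarrow>\<^bsub>G\<^esub> y"
    and f1: "(\<Sum>x\<in>H1. (f1 x)\<^sup>2) > 0" "quad_form (\<lambda>x y. x \<rightarrow>\<^bsub>G\<^esub> y) H1 f1 \<ge> \<theta> * (\<Sum>x\<in>H1. (f1 x)\<^sup>2)"
    and f2: "(\<Sum>x\<in>H2. (f2 x)\<^sup>2) > 0" "quad_form (\<lambda>x y. x \<rightarrow>\<^bsub>G\<^esub> y) H2 f2 \<ge> \<theta> * (\<Sum>x\<in>H2. (f2 x)\<^sup>2)"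
  shows "lambda2 G \<ge> \<theta>"
proof -
  interpret Digraph.graph G by (rule G)
  define vs where "vs = vertex_enum G"
  have vs: "distinct vs" "set vs = verts G" using vertex_enum[of G] by (auto simp: vs_def)
  define n where "n = length vs"
  \<comment> \<open>Two vertices guarantee that index 1 of the eigenvalue list is a genuine
    entry.\<close>
  have n: "n \<ge> 2" using G(2) distinct_card[OF vs(1)] vs(2) by (simp add: n_def)
  define A where "A = adjacency_matrix G"
  have A_eq: "A = mat n n (\<lambda>(i, j). if vs ! i \<rightarrow>\<^bsub>G\<^esub> vs ! j then 1 else 0)"
    by (simp add: A_def adjacency_matrix_def adjacency_matrix_wrt_def vs_def n_def)
  have A: "A \<in> carrier_mat n n" by (simp add: A_eq)
  have symA: "A\<^sup>T = A"
    by (rule eq_matI) (auto simp: A_eq dest: graph_symmetric)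
  have sum_vs: "(\<Sum>i<n. h (vs ! i)) = sum h (verts G)" for h :: "'a \<Rightarrow> real"
    using sum.reindex_bij_betw[OF bij_betw_nth[OF vs(1) refl refl], of h] vs(2) n_def by simp
  define vec_of where "vec_of f = vec n (\<lambda>i. f (vs ! i))" for f :: "'a \<Rightarrow> real"
  have norm: "vec_of f \<bullet> vec_of f = (\<Sum>x\<in>verts G. (f x)\<^sup>2)" for f
    using sum_vs[of "\<lambda>x. (f x)\<^sup>2"] by (simp add: vec_of_def scalar_prod_def lessThan_atLeast0 power2_eq_square)
  have form: "vec_of f \<bullet> (A *\<^sub>v vec_of f) = quad_form (\<lambda>x y. x \<rightarrow>\<^bsub>G\<^esub> y) (verts G) f" for f
  proof -
    have "vec_of f \<bullet> (A *\<^sub>v vec_of f)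
        = (\<Sum>i<n. \<Sum>j<n. if vs ! i \<rightarrow>\<^bsub>G\<^esub> vs ! j then f (vs ! i) * f (vs ! j) else 0)"
      by (auto simp: vec_of_def A_eq scalar_prod_def lessThan_atLeast0 sum_distrib_left intro!: sum.cong)
    then show ?thesis
      unfolding quad_form_def sum_vs[of "\<lambda>y. if _ \<rightarrow>\<^bsub>G\<^esub> y then f _ * f y else 0"]
      using sum_vs[of "\<lambda>x. \<Sum>y\<in>verts G. if x \<rightarrow>\<^bsub>G\<^esub> y then f x * f y else 0"] by simp
  qed
  define g1 g2 where "g1 = (\<lambda>x. if x \<in> H1 then f1 x else 0)" and "g2 = (\<lambda>x. if x \<in> H2 then f2 x else 0)"
  obtain a b where ab: "a \<noteq> 0 \<or> b \<noteq> 0"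
    and le: "(a \<cdot>\<^sub>v vec_of g1 + b \<cdot>\<^sub>v vec_of g2) \<bullet> (A *\<^sub>v (a \<cdot>\<^sub>v vec_of g1 + b \<cdot>\<^sub>v vec_of g2)) \<le>
      lambda2 G * ((a \<cdot>\<^sub>v vec_of g1 + b \<cdot>\<^sub>v vec_of g2) \<bullet> (a \<cdot>\<^sub>v vec_of g1 + b \<cdot>\<^sub>v vec_of g2))"
    using second_eigenvalue_bound_on_plane[OF A symA n, of "vec_of g1" "vec_of g2"]
    unfolding lambda2_def adjacency_eigenvalues_def A_def by (auto simp: vec_of_def)
  define q1 q2 s1 s2 where "q1 = quad_form (\<lambda>x y. x \<rightarrow>\<^bsub>G\<^esub> y) H1 f1" and "q2 = quad_form (\<lambda>x y. x \<rightarrow>\<^bsub>G\<^esub> y) H2 f2"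
    and "s1 = (\<Sum>x\<in>H1. (f1 x)\<^sup>2)" and "s2 = (\<Sum>x\<in>H2. (f2 x)\<^sup>2)"
  note defs = q1_def q2_def s1_def s2_def
  have "a \<cdot>\<^sub>v vec_of g1 + b \<cdot>\<^sub>v vec_of g2 = vec_of (\<lambda>x. a * g1 x + b * g2 x)"
    by (auto simp: vec_of_def)
  moreover have "symp (\<lambda>x y. x \<rightarrow>\<^bsub>G\<^esub> y)" by (intro sympI) (rule graph_symmetric)
  note quad_form_two_separated[OF finite_verts H this sep, where ?f1.0 = f1 and ?f2.0 = f2 and a = a and b = b, folded g1_def g2_def defs]
  ultimately have "a\<^sup>2 * q1 + b\<^sup>2 * q2 \<le> lambda2 G * (a\<^sup>2 * s1 + b\<^sup>2 * s2)"
    using le norm form by (simp add: g1_def g2_def)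
  moreover have "\<theta> * (a\<^sup>2 * s1 + b\<^sup>2 * s2) \<le> a\<^sup>2 * q1 + b\<^sup>2 * q2"
    using mult_left_mono[OF f1(2), of "a\<^sup>2"] mult_left_mono[OF f2(2), of "b\<^sup>2"]
    by (simp add: defs algebra_simps)
  ultimately have "\<theta> * (a\<^sup>2 * s1 + b\<^sup>2 * s2) \<le> lambda2 G * (a\<^sup>2 * s1 + b\<^sup>2 * s2)" by linarith
  \<comment> \<open>This is the squared norm of the chosen vector; being positive, it can be
    cancelled.\<close>
  moreover have "a\<^sup>2 * s1 + b\<^sup>2 * s2 > 0"
    using ab f1(1) f2(1) by (auto simp: defs intro: add_pos_nonneg add_nonneg_pos)
  ultimately show ?thesis by simp
qed

section \<open>From the eigenvalue bound to toughness\<close>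

theorem theorem1p5:
  fixes G :: "('a, 'b) pre_digraph" and k :: nat
  assumes "Digraph.graph G"
    and "Digraph_Component.connected G"
    and "card (verts G) \<ge> 2"
    and "regular G k"
    and "lambda2 G < (if odd k then (real k - 2 + sqrt (real k ^ 2 + 8)) / 2
                      else (real k - 2 + sqrt (real k ^ 2 + 12)) / 2)"
  shows "toughness G \<ge> 1"
proof -
  interpret Digraph.graph G by (rule assms)
  interpret R: regular_relation "verts G" "\<lambda>x y. x \<rightarrow>\<^bsub>G\<^esub> y" k
    by (rule graph_regular_relation[OF assms(1,4)])
  \<comment> \<open>The slack of the boundary below \<open>k + 1\<close>; \<open>4 * m\<close> is
    the 8 or 12 under the square root.\<close>
  define m :: nat where "m = (if odd k then 2 else 3)"
  define \<theta> where "\<theta> = (real k - 2 + sqrt (real k ^ 2 + 4 * real m)) / 2"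
  have m: "m \<ge> 1" by (simp add: m_def)
  have \<theta>: "lambda2 G < \<theta>" using assms(5) by (auto simp: \<theta>_def m_def split: if_splits)
  have tough: "num_components (G \<restriction> (verts G - S)) \<le> card S" if "S \<in> disconnecting_sets G" for S
  proof (rule ccontr)
    assume few: "\<not> ?thesis"
    have S: "S \<subseteq> verts G" and c2: "num_components (G \<restriction> (verts G - S)) \<ge> 2"
      using that by (auto simp: disconnecting_sets_def)
    define C where "C = pre_digraph.sccs_verts (G \<restriction> (verts G - S))"
    note C = induced_components[OF assms(1) S, folded C_def]
    have "\<exists>H1\<in>C. \<exists>H2\<in>C. H1 \<noteq> H2 \<and> arc_count (\<lambda>x y. x \<rightarrow>\<^bsub>G\<^esub> y) H1 (verts G - H1) < k
        \<and> arc_count (\<lambda>x y. x \<rightarrow>\<^bsub>G\<^esub> y) H2 (verts G - H2) < k"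
      by (rule R.two_low_boundary_parts[OF S C(1-3) _ _ C(5) connected_boundary_pos[OF assms(1,2)]])
        (use c2 few C(4) in auto)
    then obtain H1 H2 where H: "H1 \<in> C" "H2 \<in> C" "H1 \<noteq> H2"
      and low: "arc_count (\<lambda>x y. x \<rightarrow>\<^bsub>G\<^esub> y) H1 (verts G - H1) < k"
        "arc_count (\<lambda>x y. x \<rightarrow>\<^bsub>G\<^esub> y) H2 (verts G - H2) < k"
      by blast
    have test: "\<exists>f. (\<Sum>x\<in>H. (f x)\<^sup>2) > 0 \<and> quad_form (\<lambda>x y. x \<rightarrow>\<^bsub>G\<^esub> y) H f \<ge> \<theta> * (\<Sum>x\<in>H. (f x)\<^sup>2)"
      if "H \<in> C" "arc_count (\<lambda>x y. x \<rightarrow>\<^bsub>G\<^esub> y) H (verts G - H) < k" for H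
    proof -
      have H: "H \<subseteq> verts G" "H \<noteq> {}" using that(1) C(1,3) by auto
      show ?thesis
        unfolding \<theta>_def by (rule R.low_boundary_test_vector[OF H(1) m])
          (use R.low_boundary_parity[OF H(1) that(2)] R.low_boundary_imp_large[OF H that(2)] in \<open>auto simp: m_def\<close>)
    qed
    obtain f1 f2 :: "'a \<Rightarrow> real"
      where f1: "(\<Sum>x\<in>H1. (f1 x)\<^sup>2) > 0" "quad_form (\<lambda>x y. x \<rightarrow>\<^bsub>G\<^esub> y) H1 f1 \<ge> \<theta> * (\<Sum>x\<in>H1. (f1 x)\<^sup>2)"
        and f2: "(\<Sum>x\<in>H2. (f2 x)\<^sup>2) > 0" "quad_form (\<lambda>x y. x \<rightarrow>\<^bsub>G\<^esub> y) H2 f2 \<ge> \<theta> * (\<Sum>x\<in>H2. (f2 x)\<^sup>2)"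
      using test[OF H(1) low(1)] test[OF H(2) low(2)] by blast
    have sub: "H1 \<subseteq> verts G" "H2 \<subseteq> verts G - S" using H C(1) by auto
    have disj: "H1 \<inter> H2 = {}" using C(2) H by (simp add: pairwise_def disjnt_def)
    have "lambda2 G \<ge> \<theta>"
      \<comment> \<open>Arcs from \<open>H1\<close> stay in \<open>H1\<close> or end in
        \<open>S\<close>, and \<open>H2\<close> meets neither.\<close>
      by (rule lambda2_ge_of_separated_test_vectors[OF assms(1,3) sub(1) _ disj _ f1 f2]) (use sub disj C(5)[OF H(1)] in blast)+
    then show False using \<theta> by simp
  qed
  show ?thesis
  proof (cases "disconnecting_sets G = {}")
    case False
    \<comment> \<open>Finiteness makes \<open>Min\<close> a true minimum, so a bound on each
      quotient suffices.\<close>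
    have "finite (disconnecting_sets G)"
      by (rule finite_subset[of _ "Pow (verts G)"]) (auto simp: disconnecting_sets_def)
    moreover have "1 \<le> real (card S) / real (num_components (G \<restriction> (verts G - S)))"
      if "S \<in> disconnecting_sets G" for S
      using tough[OF that] that by (simp add: disconnecting_sets_def le_divide_eq)
    ultimately show ?thesis using False by (simp add: toughness_def one_ereal_def)
  qed (simp add: toughness_def)
qed

end
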